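(* Let $(X,d)$ be a metric space and let $f_n:X\to X$, $n\ge 0$, be a sequence of maps, defining the non-autonomous discrete system $x_{n+1}=f_n(x_n)$, $n\ge0$. Let $N\ge 2$ and let $A=(a_{ij})_{N\times N}$ be an irreducible transition matrix with $\sum_{j=1}^{N}a_{i_0j}\ge 2$ for some $1\le i_0\le N$. Let $V_1,\dots,V_N$ be pairwise disjoint nonempty compact subsets of $X$, assume that $f_n$ is continuous in $\bigcup_{i=1}^N V_i$ for every $n\ge0$, and for each $1\le i\le N$ let $\{V_{i,n}\}_{n=0}^\infty$ be a sequence of nonempty closed subsets of $V_i$. For $\alpha=(a_0,a_1,\dots)\in\Sigma_N^+(A)$ and $m,n\ge0$ put $V_\alpha^{m,n}:=\bigcap_{k=0}^{m}f_n^{-k}(V_{a_k,n+k})$. Suppose that (i) the system is weakly $A$-coupled-expanding in $\{V_{i,n}\}_{n=0}^\infty$, $1\le i\le N$; (ii) there exist $\beta=(b_0,b_1,\dots)\in\Sigma_N^+(A)$, an increasing sequence $\{m_k\}_{k=1}^\infty$ of positive integers, and $1\le s_0\le N$ such that $b_{m_k}=s_0$ for all $k\ge1$, and such that for every increasing sequence $\{n_k\}_{k=1}^\infty$ of nonnegative integers, the diameter $d(V_\beta^{m_k,n_k})$ converges to $0$ as $k\to\infty$. Then the system $x_{n+1}=f_n(x_n)$, $n\ge0$, is chaotic in the strong sense of Li-Yorke.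
   Context: Notation: for $i\ge0$, $n\ge1$, $f_i^n:=f_{i+n-1}\circ\cdots\circ f_i$, and $f_i^0$ is the identity; $f_i^{-n}(B)=\{x\in X: f_i^n(x)\in B\}$. For a nonempty set $B\subset X$, $d(B):=\sup\{d(x,y):x,y\in B\}$ is its diameter. "Increasing" means strictly increasing. "$f_n$ is continuous in $\bigcup_i V_i$" means that the restriction of $f_n$ to this set is continuous. A matrix $A=(a_{ij})_{N\times N}$ ($N\ge2$) is a transition matrix if $a_{ij}\in\{0,1\}$ for all $i,j$, $\sum_{j}a_{ij}\ge1$ for all $i$, and $\sum_i a_{ij}\ge1$ for all $j$. It is irreducible if for each pair $1\le i,j\le N$ there is a positive integer $k$ such that the $(i,j)$ entry of $A^k$ is positive. $\Sigma_N^+(A):=\{(s_0,s_1,\dots): 1\le s_j\le N,\ a_{s_js_{j+1}}=1,\ j\ge0\}$. Given sequences $\{V_{i,n}\}_{n\ge0}$, $1\le i\le N$, of nonempty subsets of $X$ with $V_{i,n}\cap V_{j,n}=\partial V_{i,n}\cap\partial V_{j,n}$ for all $i\ne j$ and $n\ge0$ ($\partial$ denotes boundary), the system is weakly $A$-coupled-expanding in $\{V_{i,n}\}_{n=0}^\infty$, $1\le i\le N$, if $f_n(V_{i,n})\supset\bigcup_{j:\,a_{ij}=1}V_{j,n+1}$ for all $1\le i\le N$, $n\ge0$. The system $x_{n+1}=f_n(x_n)$ is Li-Yorke $\delta$-chaotic ($\delta>0$) if there is an uncountable set $S\subset X$ such that for all distinct $x,y\in S$, $\liminf_{n\to\infty}d(f_0^n(x),f_0^n(y))=0$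 and $\limsup_{n\to\infty}d(f_0^n(x),f_0^n(y))>\delta$. It is chaotic in the strong sense of Li-Yorke if, for some $\delta>0$, there is such a set $S$ for which, in addition, every orbit $\{f_0^n(x)\}_{n\ge0}$, $x\in S$, is bounded. *)

theory Defs
  imports
    "HOL-Analysis.Analysis"
    "Jordan_Normal_Form.Matrix"
begin

text \<open>
  The space \<open>X\<close> is the universe of a type of class \<open>metric_space\<close>, and the non-autonomous system
  is a sequence \<open>f :: nat \<Rightarrow> 'a \<Rightarrow> 'a\<close>.  The symbols \<open>1, \<dots>, N\<close> are represented by \<open>0, \<dots>, N - 1\<close>.
\<close>

text \<open>\<open>orbit_map f i n\<close> is $f_i^n = f_{i+n-1} \circ \cdots \circ f_i$.\<close>

primrec orbit_map :: "(nat \<Rightarrow> 'a \<Rightarrow> 'a) \<Rightarrow> nat \<Rightarrow> nat \<Rightarrow> 'a \<Rightarrow> 'a" where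
  "orbit_map f i 0 = id"
| "orbit_map f i (Suc n) = f (i + n) \<circ> orbit_map f i n"

definition transition_matrix :: "nat \<Rightarrow> nat mat \<Rightarrow> bool" where
  "transition_matrix N A \<longleftrightarrow>
     N \<ge> 2 \<and> A \<in> carrier_mat N N \<and>
     (\<forall>i<N. \<forall>j<N. A $$ (i, j) \<in> {0, 1}) \<and>
     (\<forall>i<N. (\<Sum>j<N. A $$ (i, j)) \<ge> 1) \<and>
     (\<forall>j<N. (\<Sum>i<N. A $$ (i, j)) \<ge> 1)"

definition irreducible_matrix :: "nat \<Rightarrow> nat mat \<Rightarrow> bool" where
  "irreducible_matrix N A \<longleftrightarrow> (\<forall>i<N. \<forall>j<N. \<exists>k>0. (A ^\<^sub>m k) $$ (i, j) > 0)"

text \<open>The one-sided symbol space $\Sigma_N^+(A)$.\<close>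

definition subshift :: "nat \<Rightarrow> nat mat \<Rightarrow> (nat \<Rightarrow> nat) set" where
  "subshift N A = {s. \<forall>j. s j < N \<and> A $$ (s j, s (Suc j)) = 1}"

text \<open>
  In \<open>W i n\<close>, the first argument is the symbol and the second one the time.  The first two
  conjuncts are the standing requirements on the sets in which coupled expansion is considered.
\<close>

definition weakly_coupled_expanding ::
  "(nat \<Rightarrow> 'a::metric_space \<Rightarrow> 'a) \<Rightarrow> nat \<Rightarrow> nat mat \<Rightarrow> (nat \<Rightarrow> nat \<Rightarrow> 'a set) \<Rightarrow> bool" where
  "weakly_coupled_expanding f N A W \<longleftrightarrow>
     (\<forall>i<N. \<forall>n. W i n \<noteq> {}) \<and>
     (\<forall>i<N. \<forall>j<N. \<forall>n. i \<noteq> j \<longrightarrow> W i n \<inter> W j n = frontier (W i n) \<inter> frontier (W j n)) \<and>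
     (\<forall>i<N. \<forall>n. (\<Union>j\<in>{j. j < N \<and> A $$ (i, j) = 1}. W j (Suc n)) \<subseteq> f n ` W i n)"

text \<open>\<open>itinerary_set f W a m n\<close> is $V_\alpha^{m,n} = \bigcap_{k=0}^m f_n^{-k}(V_{a_k,n+k})$.\<close>

definition itinerary_set ::
  "(nat \<Rightarrow> 'a \<Rightarrow> 'a) \<Rightarrow> (nat \<Rightarrow> nat \<Rightarrow> 'a set) \<Rightarrow> (nat \<Rightarrow> nat) \<Rightarrow> nat \<Rightarrow> nat \<Rightarrow> 'a set" where
  "itinerary_set f W a m n = (\<Inter>k\<in>{0..m}. orbit_map f n k -` W (a k) (n + k))"

text \<open>
  The upper limit is taken in \<open>ereal\<close>, since distances of orbits may be unbounded.
\<close>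

definition li_yorke_scrambled ::
  "(nat \<Rightarrow> 'a::metric_space \<Rightarrow> 'a) \<Rightarrow> real \<Rightarrow> 'a set \<Rightarrow> bool" where
  "li_yorke_scrambled f \<delta> S \<longleftrightarrow>
     (\<forall>x\<in>S. \<forall>y\<in>S. x \<noteq> y \<longrightarrow>
        liminf (\<lambda>n. ereal (dist (orbit_map f 0 n x) (orbit_map f 0 n y))) = 0 \<and>
        limsup (\<lambda>n. ereal (dist (orbit_map f 0 n x) (orbit_map f 0 n y))) > ereal \<delta>)"

definition li_yorke_strongly_chaotic :: "(nat \<Rightarrow> 'a::metric_space \<Rightarrow> 'a) \<Rightarrow> bool" where
  "li_yorke_strongly_chaotic f \<longleftrightarrow>
     (\<exists>\<delta>>0. \<exists>S. uncountable S \<and> li_yorke_scrambled f \<delta> S \<and>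
        (\<forall>x\<in>S. bounded (range (\<lambda>n. orbit_map f 0 n x))))"

end

theory Submission
  imports Defs
begin

text \<open>
  Symbol sequences are assembled from the blocks \<open>b 0, \<dots>, b (m k)\<close>, where two consecutive blocks
  are joined by one of two paths from \<open>s0\<close> to \<open>b 0\<close> that have the same length and pass, at the same
  moment, through two distinct successors \<open>j1\<close> and \<open>j2\<close> of \<open>i0\<close>.  Compactness realizes every such
  sequence by an orbit.  Two orbits follow the blocks simultaneously, so by (ii) they
  get arbitrarily close; whenever the connecting paths differ, they are separated by the positive
  distance between \<open>V j1\<close> and \<open>V j2\<close>.  Letting a subset of \<open>\<nat>\<close> prescribe the connecting paths, each
  number being consulted infinitely often, gives an uncountable scrambled set.
\<close>

section \<open>Itinerary sets and points with a prescribed itinerary\<close>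

lemma orbit_map_add: "orbit_map f i (n + k) x = orbit_map f (i + n) k (orbit_map f i n x)"
  by (induction k) (simp_all add: add.assoc)

lemma orbit_map_Suc_left: "orbit_map f i (Suc k) x = orbit_map f (Suc i) k (f i x)"
  using orbit_map_add[of f i 1 k x] by simp

lemma itinerary_set_0: "itinerary_set f W a 0 n = W (a 0) n"
  by (simp add: itinerary_set_def)

lemma mem_itinerary_set:
  "x \<in> itinerary_set f W a m n \<longleftrightarrow> (\<forall>k\<le>m. orbit_map f n k x \<in> W (a k) (n + k))"
  by (auto simp: itinerary_set_def)

lemma itinerary_set_subset: "itinerary_set f W a m n \<subseteq> W (a 0) n"
  using INT_lower[of 0 "{0..m}" "\<lambda>k. orbit_map f n k -` W (a k) (n + k)"]
  by (simp add: itinerary_set_def)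

text \<open>Peeling off the first symbol turns the remaining conditions into conditions on the image
  under \<open>f n\<close>, at time \<open>Suc n\<close>. Nonemptiness and closedness both follow by
  induction along this recursion, which shifts \<open>a\<close> and \<open>n\<close>
  together.\<close>

lemma itinerary_set_Suc:
  "itinerary_set f W a (Suc m) n =
     W (a 0) n \<inter> f n -` itinerary_set f W (\<lambda>k. a (Suc k)) m (Suc n)"
proof -
  have split: "(\<forall>k\<le>Suc m. P k) \<longleftrightarrow> P 0 \<and> (\<forall>k\<le>m. P (Suc k))" for P
    using All_less_Suc2[of "Suc m" P] by (simp add: less_Suc_eq_le)
  show ?thesis
    by (intro Set.set_eqI) (simp add: mem_itinerary_set split orbit_map_Suc_left del: orbit_map.simps(2))
qed

lemma subshift_shift: "a \<in> subshift N A \<Longrightarrow> (\<lambda>k. a (Suc k)) \<in> subshift N A"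
  by (simp add: subshift_def)

text \<open>Points are pulled back one step at a time: a point realizing the shifted itinerary lies
  in \<open>W (a 1) (Suc n)\<close>, which expansion covers by the image of
  \<open>W (a 0) n\<close>.\<close>

lemma itinerary_set_nonempty:
  assumes "weakly_coupled_expanding f N A W" and "a \<in> subshift N A"
  shows "itinerary_set f W a m n \<noteq> {}"
  using assms(2)
proof (induction m arbitrary: a n)
  case 0
  then show ?case
    using assms(1) by (auto simp: itinerary_set_0 weakly_coupled_expanding_def subshift_def)
next
  case (Suc m)
  obtain y where y: "y \<in> itinerary_set f W (\<lambda>k. a (Suc k)) m (Suc n)"
    using Suc.IH[OF subshift_shift[OF Suc.prems], of "Suc n"] by blast
  then have "y \<in> W (a (Suc 0)) (Suc n)"
    using itinerary_set_subset[of f W "\<lambda>k. a (Suc k)" m "Suc n"] by auto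
  moreover have "a 0 < N" "a (Suc 0) < N" "A $$ (a 0, a (Suc 0)) = 1"
    using Suc.prems by (auto simp: subshift_def)
  moreover have "(\<Union>j\<in>{j. j < N \<and> A $$ (a 0, j) = 1}. W j (Suc n)) \<subseteq> f n ` W (a 0) n"
    using assms(1) \<open>a 0 < N\<close> by (simp add: weakly_coupled_expanding_def)
  ultimately have "y \<in> f n ` W (a 0) n"
    by blast
  then show ?case
    using y by (auto simp: itinerary_set_Suc)
qed

text \<open>Since \<open>f n\<close> is continuous only on \<open>X\<close>, a bare preimage need
  not be closed; the recursion intersects it with the closed set \<open>W (a 0) n\<close>, on which
  \<open>f n\<close> is continuous.\<close>

lemma closed_itinerary_set:
  fixes f :: "nat \<Rightarrow> 'a::metric_space \<Rightarrow> 'a"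
  assumes cont: "\<And>n. continuous_on X (f n)"
    and W: "\<And>i n. i < N \<Longrightarrow> closed (W i n) \<and> W i n \<subseteq> X"
    and a: "a \<in> subshift N A"
  shows "closed (itinerary_set f W a m n)"
  using a
proof (induction m arbitrary: a n)
  case 0
  then show ?case
    using W by (auto simp: itinerary_set_0 subshift_def)
next
  case (Suc m)
  have "a 0 < N"
    using Suc.prems by (auto simp: subshift_def)
  then have "closed (W (a 0) n)" "continuous_on (W (a 0) n) (f n)"
    using W cont continuous_on_subset by blast+
  moreover have "closed (itinerary_set f W (\<lambda>k. a (Suc k)) m (Suc n))"
    using Suc.IH Suc.prems subshift_shift by blast
  ultimately show ?case
    unfolding itinerary_set_Suc by (intro continuous_closed_preimage)
qed

text \<open>The sets \<open>?K m\<close> are closed, nonempty and decreasing in \<open>m\<close>,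
  and lie in the compact set \<open>X\<close>, so the finite intersection property yields a common
  point.\<close>

lemma exists_orbit_with_itinerary:
  fixes f :: "nat \<Rightarrow> 'a::metric_space \<Rightarrow> 'a"
  assumes "compact X" and cont: "\<And>n. continuous_on X (f n)"
    and W: "\<And>i n. i < N \<Longrightarrow> closed (W i n) \<and> W i n \<subseteq> X"
    and exp: "weakly_coupled_expanding f N A W"
    and a: "a \<in> subshift N A"
  shows "\<exists>x. \<forall>k. orbit_map f 0 k x \<in> W (a k) k"
proof -
  let ?K = "\<lambda>m. itinerary_set f W a m 0"
  have "X \<inter> (\<Inter>m. ?K m) \<noteq> {}"
  proof (rule compact_imp_fip_image)
    show "closed (?K m)" for m
      using cont W a by (rule closed_itinerary_set)
  next
    fix I :: "nat set" assume "finite I"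
    then obtain M where "\<forall>i\<in>I. i \<le> M"
      by (meson finite_nat_set_iff_bounded_le)
    then have "?K M \<subseteq> (\<Inter>m\<in>I. ?K m)"
      by (auto simp: mem_itinerary_set)
    moreover have "?K M \<subseteq> X"
      using W[of "a 0" 0] a itinerary_set_subset[of f W a M 0] by (auto simp: subshift_def)
    ultimately show "X \<inter> (\<Inter>m\<in>I. ?K m) \<noteq> {}"
      using itinerary_set_nonempty[OF exp a, of M 0] by blast
  qed (use \<open>compact X\<close> in auto)
  then obtain x where "\<And>m. x \<in> ?K m"
    by blast
  then show ?thesis
    unfolding mem_itinerary_set by (metis add_0 order_refl)
qed

section \<open>Paths in the transition graph\<close>

text \<open>A positive entry of a matrix product has a positive summand, which extends a path by one
  edge. This turns irreducibility into reachability.\<close>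

lemma pow_mat_pos_imp_relpow:
  fixes A :: "nat mat"
  assumes A: "A \<in> carrier_mat N N"
  shows "i < N \<Longrightarrow> j < N \<Longrightarrow> (A ^\<^sub>m k) $$ (i, j) > 0 \<Longrightarrow>
    (i, j) \<in> {(i, j). i < N \<and> j < N \<and> A $$ (i, j) > 0} ^^ k"
proof (induction k arbitrary: j)
  case 0
  then show ?case
    using A by (auto split: if_splits)
next
  case (Suc k)
  have "(A ^\<^sub>m Suc k) $$ (i, j) = (\<Sum>l<N. (A ^\<^sub>m k) $$ (i, l) * A $$ (l, j))"
    using A Suc.prems by (simp add: scalar_prod_def atLeast0LessThan)
  with Suc.prems obtain l where "l < N" "(A ^\<^sub>m k) $$ (i, l) * A $$ (l, j) > 0"
    by (metis (no_types, lifting) bot_nat_0.not_eq_extremum lessThan_iff sum.neutral)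
  then show ?case
    using Suc.IH[of l] Suc.prems by auto
qed

text \<open>
  Swapping the order of two loops at \<open>i\<close> that start with \<open>i \<rightarrow> j1\<close> and \<open>i \<rightarrow> j2\<close> makes the
  lengths agree.
\<close>

lemma two_paths_of_equal_length:
  assumes "(x, i) \<in> R ^^ q" and "(i, j1) \<in> R" and "(i, j2) \<in> R"
    and "(j1, i) \<in> R ^^ r1" and "(j2, i) \<in> R ^^ r2" and "(i, y) \<in> R ^^ r"
  shows "\<exists>s t. (x, j1) \<in> R ^^ s \<and> (j1, y) \<in> R ^^ t \<and> (x, j2) \<in> R ^^ s \<and> (j2, y) \<in> R ^^ t"
proof (intro exI conjI)
  show "(x, j1) \<in> R ^^ Suc q" "(x, j2) \<in> R ^^ Suc q"
    using assms by auto
  show "(j1, y) \<in> R ^^ (Suc r1 + (r2 + r))"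
    unfolding relpow_add using assms by auto
  have "(j2, y) \<in> R ^^ (Suc r2 + (r1 + r))"
    unfolding relpow_add using assms by auto
  then show "(j2, y) \<in> R ^^ (Suc r1 + (r2 + r))"
    by (simp add: add_ac)
qed

text \<open>Joins two paths at their common point \<open>y\<close> and records the moment
  \<open>s\<close> at which it is visited; that moment is where orbits are later separated.\<close>

lemma path_through:
  assumes "(x, y) \<in> R ^^ s" and "(y, z) \<in> R ^^ t"
  shows "\<exists>g. g 0 = x \<and> g s = y \<and> g (s + t) = z \<and> (\<forall>k<s + t. (g k, g (Suc k)) \<in> R)"
proof -
  obtain u where u: "u 0 = x" "u s = y" "\<And>k. k < s \<Longrightarrow> (u k, u (Suc k)) \<in> R"
    using assms(1) unfolding relpow_fun_conv by blast
  obtain v where v: "v 0 = y" "v t = z" "\<And>k. k < t \<Longrightarrow> (v k, v (Suc k)) \<in> R"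
    using assms(2) unfolding relpow_fun_conv by blast
  define g where "g k = (if k \<le> s then u k else v (k - s))" for k
  have "(g k, g (Suc k)) \<in> R" if "k < s + t" for k
  proof (cases "k < s")
    case True
    then show ?thesis by (simp add: g_def u)
  next
    case False
    then have "g k = v (k - s)" "g (Suc k) = v (Suc (k - s))"
      using u v by (auto simp: g_def Suc_diff_le)
    then show ?thesis
      using False that v(3)[of "k - s"] by simp
  qed
  then show ?thesis
    using u v by (intro exI[of _ g]) (auto simp: g_def)
qed

section \<open>Concatenation of words\<close>

lemma strict_mono_between:
  fixes p :: "nat \<Rightarrow> nat"
  assumes "strict_mono p" and "p 0 \<le> n"
  obtains k where "p k \<le> n" and "n < p (Suc k)"
proof -
  have "\<exists>k. n < p k"
    by (metis assms(1) lessI less_le_trans strict_mono_imp_increasing)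
  then have *: "n < p (LEAST k. n < p k)"
    by (rule LeastI_ex)
  then obtain k where k: "(LEAST k. n < p k) = Suc k"
    using assms(2) by (metis not0_implies_Suc not_less)
  then have "p k \<le> n"
    by (metis lessI not_less not_less_Least)
  with * k that show ?thesis
    by simp
qed

text \<open>Consecutive words share the letter at their seam, so every step of the long sequence
  lies inside a single word and inherits \<open>R\<close> from it.\<close>

lemma concatenate_words:
  fixes p :: "nat \<Rightarrow> nat" and w :: "nat \<Rightarrow> nat \<Rightarrow> 'b"
  assumes p: "strict_mono p" "p 0 = 0"
    and glue: "\<And>k. w k (p (Suc k) - p k) = w (Suc k) 0"
    and R: "\<And>k t. t < p (Suc k) - p k \<Longrightarrow> R (w k t) (w k (Suc t))"
  shows "\<exists>a. (\<forall>k. \<forall>t \<le> p (Suc k) - p k. a (p k + t) = w k t) \<and> (\<forall>n. R (a n) (a (Suc n)))"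
proof -
  define K where "K n = (SOME k. p k \<le> n \<and> n < p (Suc k))" for n
  have K: "p (K n) \<le> n \<and> n < p (Suc (K n))" for n
    unfolding K_def by (rule someI_ex) (metis strict_mono_between p zero_le)
  have unique: "K n = k" if "p k \<le> n" "n < p (Suc k)" for n k
  proof -
    have "K n < Suc k" "k < Suc (K n)"
      using K[of n] that p(1) by (meson le_less_trans strict_mono_less)+
    then show ?thesis by simp
  qed
  have less: "p k < p (Suc k)" for k
    using p(1) by (simp add: strict_mono_less)
  define a where "a n = w (K n) (n - p (K n))" for n
  have a_less: "a (p k + t) = w k t" if "t < p (Suc k) - p k" for k t
    using unique[of k "p k + t"] that by (simp add: a_def)
  \<comment> \<open>At the right endpoint the letter is defined by the next word;
    \<open>glue\<close> identifies it with the last letter of word \<open>k\<close>.\<close>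
  have a: "a (p k + t) = w k t" if "t \<le> p (Suc k) - p k" for k t
  proof (cases "t = p (Suc k) - p k")
    case True
    then show ?thesis
      using a_less[of 0 "Suc k"] less[of k] less[of "Suc k"] glue[of k] by simp
  qed (use that a_less in simp)
  have "R (a n) (a (Suc n))" for n
  proof -
    define t where "t = n - p (K n)"
    have n: "n = p (K n) + t" and t: "t < p (Suc (K n)) - p (K n)"
      using K[of n] by (auto simp: t_def)
    have "a n = w (K n) t" "a (Suc n) = w (K n) (Suc t)"
      using a[of t "K n"] a[of "Suc t" "K n"] t n by auto
    then show ?thesis
      using R t by simp
  qed
  with a show ?thesis by blast
qed

section \<open>Lower and upper limits, diameters and distances\<close>

lemma liminf_dist_eq_0:
  fixes u v :: "nat \<Rightarrow> 'a::metric_space"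
  assumes "strict_mono r" and "(\<lambda>k. dist (u (r k)) (v (r k))) \<longlonglongrightarrow> 0"
  shows "liminf (\<lambda>n. ereal (dist (u n) (v n))) = 0"
proof (rule antisym)
  have "(\<lambda>k. ereal (dist (u (r k)) (v (r k)))) \<longlonglongrightarrow> 0"
    using assms(2) by (simp add: zero_ereal_def)
  then have "liminf ((\<lambda>n. ereal (dist (u n) (v n))) \<circ> r) = 0"
    by (simp add: lim_imp_Liminf o_def)
  then show "liminf (\<lambda>n. ereal (dist (u n) (v n))) \<le> 0"
    using liminf_subseq_mono[OF assms(1)] by metis
  show "0 \<le> liminf (\<lambda>n. ereal (dist (u n) (v n)))"
    by (rule Liminf_bounded) simp
qed

lemma limsup_ge_of_frequently:
  fixes u :: "nat \<Rightarrow> 'a::complete_linorder"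
  assumes "\<exists>\<^sub>F n in sequentially. c \<le> u n"
  shows "c \<le> limsup u"
proof (rule ccontr)
  assume "\<not> c \<le> limsup u"
  then have "\<forall>\<^sub>F n in sequentially. u n < c"
    by (intro Limsup_lessD) simp
  then show False
    using assms by (auto simp: frequently_def not_le)
qed

text \<open>Boundedness matters here: \<open>diameter\<close> is a real supremum, which is sure to
  dominate distances only on bounded sets.\<close>

lemma dist_le_diameter_itinerary_set:
  assumes "bounded (W (a 0) n)"
    and "x \<in> itinerary_set f W a m n" and "y \<in> itinerary_set f W a m n"
  shows "dist x y \<le> diameter (itinerary_set f W a m n)"
proof (rule diameter_bounded_bound)
  show "bounded (itinerary_set f W a m n)"
    using assms(1) itinerary_set_subset by (rule bounded_subset)
qed (use assms in auto)

text \<open>The distance attains its minimum on the compact product, and disjointness makes it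
  positive.\<close>

lemma disjoint_compact_sets_apart:
  fixes S T :: "'a::metric_space set"
  assumes "compact S" and "compact T" and "S \<inter> T = {}"
  shows "\<exists>d>0. \<forall>x\<in>S. \<forall>y\<in>T. d \<le> dist x y"
proof (cases "S \<times> T = {}")
  case True
  then show ?thesis
    by (intro exI[of _ 1]) auto
next
  case False
  have "compact (S \<times> T)"
    using assms by (intro compact_Times)
  moreover have "continuous_on (S \<times> T) (\<lambda>z. dist (fst z) (snd z))"
    by (intro continuous_intros)
  ultimately obtain z where z: "z \<in> S \<times> T"
    "\<forall>z'\<in>S \<times> T. dist (fst z) (snd z) \<le> dist (fst z') (snd z')"
    using False continuous_attains_inf by blast
  then have "dist (fst z) (snd z) > 0"
    using assms(3) by auto
  then show ?thesis
    using z(2) by (intro exI[of _ "dist (fst z) (snd z)"]) auto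
qed

theorem corollary3p1:
  fixes f :: "nat \<Rightarrow> 'a::metric_space \<Rightarrow> 'a"
    and N i0 s0 :: nat
    and A :: "nat mat"
    and V :: "nat \<Rightarrow> 'a set"
    and W :: "nat \<Rightarrow> nat \<Rightarrow> 'a set"
    and b m :: "nat \<Rightarrow> nat"
  assumes "transition_matrix N A"
    and "irreducible_matrix N A"
    and "i0 < N" and "(\<Sum>j<N. A $$ (i0, j)) \<ge> 2"
    and "disjoint_family_on V {..<N}"
    and "\<And>i. i < N \<Longrightarrow> V i \<noteq> {} \<and> compact (V i)"
    and "\<And>n. continuous_on (\<Union>i<N. V i) (f n)"
    and "\<And>i n. i < N \<Longrightarrow> W i n \<noteq> {} \<and> closed (W i n) \<and> W i n \<subseteq> V i"
    and "weakly_coupled_expanding f N A W"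
    and "b \<in> subshift N A"
    and "strict_mono m" and "\<And>k. m k > 0"
    and "s0 < N" and "\<And>k. b (m k) = s0"
    and "\<And>n :: nat \<Rightarrow> nat. strict_mono n \<Longrightarrow>
           (\<lambda>k. diameter (itinerary_set f W b (m k) (n k))) \<longlonglongrightarrow> 0"
  shows "li_yorke_strongly_chaotic f"
proof -
  note trans = assms(1) and irr = assms(2) and V = assms(6) and cont = assms(7)
    and W = assms(8) and exp = assms(9) and b = assms(10) and m_mono = assms(11)
    and bm = assms(14) and diam = assms(15)
  define X where "X = (\<Union>i<N. V i)"
  have "compact X"
    unfolding X_def using V by (intro compact_UN) auto
  have WX: "closed (W i n) \<and> W i n \<subseteq> X" if "i < N" for i n
    using W[OF that] that unfolding X_def by blast
  have A: "A \<in> carrier_mat N N" and A01: "\<And>i j. i < N \<Longrightarrow> j < N \<Longrightarrow> A $$ (i, j) \<in> {0, 1}"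
    using trans by (auto simp: transition_matrix_def)
  \<comment> \<open>The form \<open>> 0\<close> matches matrix powers; as the entries are 0 or 1,
    \<open>R_iff\<close> recovers the form \<open>= 1\<close> of \<open>subshift\<close>.\<close>
  define R where "R = {(i, j). i < N \<and> j < N \<and> A $$ (i, j) > 0}"
  have R_iff: "(i, j) \<in> R \<longleftrightarrow> i < N \<and> j < N \<and> A $$ (i, j) = 1" for i j
    using A01[of i j] by (auto simp: R_def)
  have conn: "\<exists>k. (i, j) \<in> R ^^ k" if "i < N" "j < N" for i j
    using irr that pow_mat_pos_imp_relpow[OF A that] unfolding irreducible_matrix_def R_def by blast
  have b_R: "(b k, b (Suc k)) \<in> R" for k
    using b by (auto simp: subshift_def R_iff)
  then have "b 0 < N"
    by (auto simp: R_def)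

  \<comment> \<open>The two connecting paths\<close>
  obtain j1 j2 where j: "(i0, j1) \<in> R" "(i0, j2) \<in> R" "j1 \<noteq> j2"
  proof -
    \<comment> \<open>The row sum of a 0-1 matrix counts the successors of
      \<open>i0\<close>.\<close>
    have "(\<Sum>j<N. A $$ (i0, j)) = (\<Sum>j<N. if A $$ (i0, j) = 1 then 1 else 0)"
      using A01[OF \<open>i0 < N\<close>] by (intro sum.cong) auto
    also have "\<dots> = card {j \<in> {..<N}. A $$ (i0, j) = 1}"
      by (simp add: sum.If_cases Int_def)
    finally have "2 \<le> card {j \<in> {..<N}. A $$ (i0, j) = 1}"
      using assms(4) by simp
    then obtain j1 j2 where "j1 \<in> {j \<in> {..<N}. A $$ (i0, j) = 1}"
      "j2 \<in> {j \<in> {..<N}. A $$ (i0, j) = 1}" "j1 \<noteq> j2"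
      by (meson card_2_iff' ex_card subset_iff)
    then show ?thesis
      using that \<open>i0 < N\<close> by (auto simp: R_iff)
  qed
  then have jN: "j1 < N" "j2 < N"
    by (auto simp: R_def)
  obtain q r where qr: "(s0, j1) \<in> R ^^ q" "(j1, b 0) \<in> R ^^ r"
    "(s0, j2) \<in> R ^^ q" "(j2, b 0) \<in> R ^^ r"
    using two_paths_of_equal_length[of s0 i0 _ R j1 j2 _ _ "b 0"] j jN conn
      \<open>s0 < N\<close> \<open>i0 < N\<close> \<open>b 0 < N\<close> by meson
  define L where "L = q + r"
  have "\<exists>g. g 0 = s0 \<and> g q = (if c then j1 else j2) \<and> g L = b 0 \<and> (\<forall>k<L. (g k, g (Suc k)) \<in> R)" for c
    unfolding L_def using qr by (intro path_through) auto
  then obtain g where g: "\<And>c. g c 0 = s0" "\<And>c. g c q = (if c then j1 else j2)"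
    "\<And>c. g c L = b 0" "\<And>c k. k < L \<Longrightarrow> (g c k, g c (Suc k)) \<in> R"
    by metis

  \<comment> \<open>Symbol sequences governed by a choice \<open>c\<close>, and their orbits\<close>
  \<comment> \<open>Block \<open>k\<close> starts at time \<open>p k\<close>: \<open>m k\<close>
    steps along \<open>b\<close>, then \<open>L\<close> steps along a connecting path. Both paths
    have length \<open>L\<close>, so \<open>p\<close> does not depend on \<open>c\<close>.\<close>
  define p where "p k = (\<Sum>i<k. m i + L)" for k
  have p: "strict_mono p" "p 0 = 0" "\<And>k. p (Suc k) = p k + (m k + L)"
    using assms(12) by (auto simp: p_def strict_mono_Suc_iff)
  \<comment> \<open>The two branches agree at \<open>t = m k\<close> because
    \<open>b (m k) = s0 = g (c k) 0\<close>; the word ends in \<open>b 0\<close>, where the next one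
    begins.\<close>
  define w where "w c k t = (if t \<le> m k then b t else g (c k) (t - m k))"
    for c :: "nat \<Rightarrow> bool" and k t
  have w_path: "w c k (m k + t) = g (c k) t" for c k t
    using g(1) bm by (simp add: w_def)
  have w_R: "(w c k t, w c k (Suc t)) \<in> R" if "t < m k + L" for c k t
  proof (cases "t < m k")
    case True
    then show ?thesis
      using b_R by (simp add: w_def)
  next
    case False
    then have "t = m k + (t - m k)" "t - m k < L"
      using \<open>t < m k + L\<close> by auto
    then show ?thesis
      using w_path[of c k "t - m k"] w_path[of c k "Suc (t - m k)"] g(4) by simp
  qed
  have "\<exists>a. (\<forall>k. \<forall>t \<le> m k + L. a (p k + t) = w c k t) \<and> (\<forall>n. (a n, a (Suc n)) \<in> R)" for c
    using concatenate_words[of p "w c" "\<lambda>x y. (x, y) \<in> R"] p w_R w_path g(3)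
    by (simp add: w_def)
  then obtain a where a: "\<And>c k t. t \<le> m k + L \<Longrightarrow> a c (p k + t) = w c k t"
    "\<And>c n. (a c n, a c (Suc n)) \<in> R"
    by metis
  have "a c \<in> subshift N A" for c
    using a(2)[of c] by (auto simp: subshift_def R_iff)
  then have "\<exists>x. \<forall>k. orbit_map f 0 k x \<in> W (a c k) k" for c
    using exists_orbit_with_itinerary[of X f N W A] \<open>compact X\<close> cont WX exp by (simp add: X_def)
  then obtain x where x: "\<And>c k. orbit_map f 0 k (x c) \<in> W (a c k) k"
    by metis
  have aN: "a c k < N" for c k
    using a(2)[of c k] by (simp add: R_def)

  \<comment> \<open>Proximality and separation of the orbits\<close>
  have close: "liminf (\<lambda>n. ereal (dist (orbit_map f 0 n (x c)) (orbit_map f 0 n (x c')))) = 0" for c c'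
  proof (rule liminf_dist_eq_0[OF p(1)])
    \<comment> \<open>For every choice \<open>c\<close> the orbit enters the same itinerary set at
      the same time \<open>p k\<close>, so hypothesis (ii) with \<open>n = p\<close> brings any two
      orbits together.\<close>
    have mem: "orbit_map f 0 (p k) (x c) \<in> itinerary_set f W b (m k) (p k)" for c k
      unfolding mem_itinerary_set
    proof (intro allI impI)
      fix t assume "t \<le> m k"
      then show "orbit_map f (p k) t (orbit_map f 0 (p k) (x c)) \<in> W (b t) (p k + t)"
        using x[where c=c and k="p k + t"] a(1)[of t k c] orbit_map_add[of f 0 "p k" t "x c"]
        by (simp add: w_def)
    qed
    have "bounded (W (b 0) n)" for n
      using WX[OF \<open>b 0 < N\<close>] compact_imp_bounded[OF \<open>compact X\<close>] by (meson bounded_subset)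
    then have "norm (dist (orbit_map f 0 (p k) (x c)) (orbit_map f 0 (p k) (x c')))
        \<le> diameter (itinerary_set f W b (m k) (p k))" for k
      using mem by (simp add: dist_le_diameter_itinerary_set)
    then show "(\<lambda>k. dist (orbit_map f 0 (p k) (x c)) (orbit_map f 0 (p k) (x c'))) \<longlonglongrightarrow> 0"
      using diam[OF p(1)] by (rule Lim_null_comparison[OF always_eventually[OF allI]])
  qed

  obtain d where "d > 0" and d: "\<And>y z. y \<in> V j1 \<Longrightarrow> z \<in> V j2 \<Longrightarrow> d \<le> dist y z"
  proof -
    have "V j1 \<inter> V j2 = {}"
      using assms(5) j(3) jN by (auto simp: disjoint_family_on_def)
    then show ?thesis
      using disjoint_compact_sets_apart V jN that by metis
  qed
  \<comment> \<open>\<open>q\<close> steps into connecting path \<open>k\<close>, the symbols are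
    \<open>j1\<close> and \<open>j2\<close> if the choices differ.\<close>
  have far: "d \<le> dist (orbit_map f 0 (p k + (m k + q)) (x c)) (orbit_map f 0 (p k + (m k + q)) (x c'))"
    if "c k \<noteq> c' k" for c c' k
  proof -
    have "orbit_map f 0 (p k + (m k + q)) (x c) \<in> V (if c k then j1 else j2)" for c
    proof -
      have "a c (p k + (m k + q)) = (if c k then j1 else j2)"
        using a(1)[of "m k + q" k c] w_path[of c k q] g(2) by (simp add: L_def)
      moreover have "orbit_map f 0 (p k + (m k + q)) (x c) \<in> V (a c (p k + (m k + q)))"
        using x[where c=c and k="p k + (m k + q)"] W[OF aN[of c "p k + (m k + q)"]] by blast
      ultimately show ?thesis
        by simp
    qed
    from this[of c] this[of c'] that show ?thesis
      by (cases "c k") (simp_all add: d, metis d dist_commute)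
  qed

  \<comment> \<open>An uncountable scrambled set\<close>
  \<comment> \<open>Each number \<open>e\<close> is consulted at all indices
    \<open>prod_encode (e, n)\<close>, which are at least \<open>n\<close>; hence distinct sets give
    choices that differ infinitely often.\<close>
  define code :: "nat set \<Rightarrow> nat \<Rightarrow> bool" where "code E k \<longleftrightarrow> fst (prod_decode k) \<in> E" for E k
  have code_diff: "\<exists>k\<ge>n. code E k \<noteq> code E' k" if "E \<noteq> E'" for E E' n
  proof -
    obtain e where "(e \<in> E) \<noteq> (e \<in> E')"
      using \<open>E \<noteq> E'\<close> by blast
    then have "code E (prod_encode (e, n)) \<noteq> code E' (prod_encode (e, n))"
      by (simp add: code_def)
    then show ?thesis
      using le_prod_encode_2 by blast
  qed
  have inj: "inj (\<lambda>E. x (code E))"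
  proof (rule injI, rule ccontr)
    fix E E' assume eq: "x (code E) = x (code E')" and "E \<noteq> E'"
    then obtain k where "code E k \<noteq> code E' k"
      using code_diff by blast
    then show False
      using far[of "code E" k "code E'"] eq \<open>d > 0\<close> by simp
  qed
  \<comment> \<open>The separation bounds the upper limit below by \<open>d\<close>; halving
    \<open>d\<close> makes the inequality strict.\<close>
  have apart: "ereal (d / 2) < limsup (\<lambda>n. ereal (dist (orbit_map f 0 n (x (code E))) (orbit_map f 0 n (x (code E')))))"
    if "E \<noteq> E'" for E E'
  proof -
    have "\<exists>n\<ge>n0. d \<le> dist (orbit_map f 0 n (x (code E))) (orbit_map f 0 n (x (code E')))" for n0
    proof -
      obtain k where "k \<ge> n0" "code E k \<noteq> code E' k"
        using code_diff[OF \<open>E \<noteq> E'\<close>] by blast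
      \<comment> \<open>Ensures that the times of separation are arbitrarily late.\<close>
      moreover have "k \<le> p k"
        using p(1) by (rule strict_mono_imp_increasing)
      ultimately show ?thesis
        using far[of "code E" k "code E'"] by (intro exI[of _ "p k + (m k + q)"]) simp
    qed
    then have "ereal d \<le> limsup (\<lambda>n. ereal (dist (orbit_map f 0 n (x (code E))) (orbit_map f 0 n (x (code E')))))"
      by (intro limsup_ge_of_frequently) (simp add: frequently_sequentially)
    moreover have "ereal (d / 2) < ereal d"
      using \<open>d > 0\<close> by simp
    ultimately show ?thesis
      by (rule less_le_trans[rotated])
  qed

  show ?thesis
    unfolding li_yorke_strongly_chaotic_def
  proof (intro exI conjI)
    show "d / 2 > 0"
      using \<open>d > 0\<close> by simp
    have "uncountable (UNIV :: nat set set)"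
      unfolding uncountable_def using Cantors_theorem[of "UNIV :: nat set"] by auto
    then show "uncountable (range (\<lambda>E. x (code E)))"
      using inj countable_image_inj_on by blast
    show "li_yorke_scrambled f (d / 2) (range (\<lambda>E. x (code E)))"
      unfolding li_yorke_scrambled_def by (auto intro!: close apart)
    \<comment> \<open>Orbits never leave the compact set \<open>X\<close>, hence are
      bounded.\<close>
    have "orbit_map f 0 n (x c) \<in> X" for n c
      using x[where c=c and k=n] WX[OF aN[of c n], of n] by blast
    then have "range (\<lambda>n. orbit_map f 0 n (x c)) \<subseteq> X" for c
      by blast
    then show "\<forall>y\<in>range (\<lambda>E. x (code E)). bounded (range (\<lambda>n. orbit_map f 0 n y))"
      using compact_imp_bounded[OF \<open>compact X\<close>] by (auto intro: bounded_subset)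
  qed
qed

end
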